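(* Let $n \ge 11$ be an integer. The unique (up to isomorphism) $(2n+1)$-vertex graph with at least $n^2+n$ edges that contains no two vertices of the same degree joined by a path of length five is the complete bipartite graph $K_{n,n+1}$. Consequently, $p_5(2n+1) = n^2+n$ for all $n \ge 11$.
   Context: All graphs are finite and simple. A path of length $\ell$ is a path with $\ell$ edges (hence $\ell+1$ distinct vertices); it joins its two endpoints, which are two distinct vertices. "Two vertices of the same degree joined by a path of length five" means two distinct vertices $u,v$ with $d(u)=d(v)$ that are the endpoints of some (not necessarily induced) path with exactly five edges in the graph. For positive integers $\ell$ and $N$, $p_\ell(N)$ denotes the maximum number of edges in an $N$-vertex graph containing no two vertices of equal degree joined by a path of length $\ell$. *)

theory Defs
  imports Main
begin

record 'a ugraph =
  verts :: "'a set"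
  edges :: "'a set set"

definition simple_graph :: "'a ugraph \<Rightarrow> bool" where
  "simple_graph G \<longleftrightarrow> finite (verts G) \<and> (\<forall>e \<in> edges G. e \<subseteq> verts G \<and> card e = 2)"

definition deg :: "'a ugraph \<Rightarrow> 'a \<Rightarrow> nat" where
  "deg G v = card {e \<in> edges G. v \<in> e}"

text \<open>A path is given by the list of its vertices in order; a path of length \<open>l\<close>
  is thus a list of \<open>l + 1\<close> vertices.\<close>

definition is_path :: "'a ugraph \<Rightarrow> 'a list \<Rightarrow> bool" where
  "is_path G p \<longleftrightarrow> p \<noteq> [] \<and> set p \<subseteq> verts G \<and> distinct p
     \<and> successively (\<lambda>x y. {x, y} \<in> edges G) p"

definition joined_by_path :: "'a ugraph \<Rightarrow> nat \<Rightarrow> 'a \<Rightarrow> 'a \<Rightarrow> bool" where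
  "joined_by_path G l u v \<longleftrightarrow> (\<exists>p. is_path G p \<and> length p = l + 1 \<and> hd p = u \<and> last p = v)"

definition has_equal_degree_path :: "'a ugraph \<Rightarrow> nat \<Rightarrow> bool" where
  "has_equal_degree_path G l \<longleftrightarrow>
     (\<exists>u \<in> verts G. \<exists>v \<in> verts G. u \<noteq> v \<and> deg G u = deg G v \<and> joined_by_path G l u v)"

definition graph_iso :: "'a ugraph \<Rightarrow> 'b ugraph \<Rightarrow> bool" where
  "graph_iso G H \<longleftrightarrow> (\<exists>f. bij_betw f (verts G) (verts H)
     \<and> (\<forall>u \<in> verts G. \<forall>v \<in> verts G. {u, v} \<in> edges G \<longleftrightarrow> {f u, f v} \<in> edges H))"

definition complete_bipartite :: "nat \<Rightarrow> nat \<Rightarrow> nat ugraph" where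
  "complete_bipartite a b =
     \<lparr>verts = {..<a + b}, edges = {{i, j} | i j. i < a \<and> a \<le> j \<and> j < a + b}\<rparr>"

text \<open>Every finite graph is isomorphic to one whose vertices are natural numbers, so it
  suffices to take the maximum over the latter.\<close>

definition p_max :: "nat \<Rightarrow> nat \<Rightarrow> nat" where
  "p_max l N = Max {card (edges G) | G :: nat ugraph.
     simple_graph G \<and> card (verts G) = N \<and> \<not> has_equal_degree_path G l}"

lemma p_max_set_finite_nonempty:
  fixes l N :: nat
  defines "S \<equiv> {card (edges G) | G :: nat ugraph.
     simple_graph G \<and> card (verts G) = N \<and> \<not> has_equal_degree_path G l}"
  shows "finite S" and "S \<noteq> {}"
proof -
  have "card (edges G) \<le> 2 ^ N" if "simple_graph G" "card (verts G) = N" for G :: "nat ugraph"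
  proof -
    have "edges G \<subseteq> Pow (verts G)" "finite (verts G)"
      using that by (auto simp: simple_graph_def)
    then show ?thesis
      using card_mono[of "Pow (verts G)" "edges G"] that by (simp add: card_Pow)
  qed
  then have "S \<subseteq> {..2 ^ N}" by (auto simp: S_def)
  then show "finite S" using finite_subset by blast
  let ?G = "\<lparr>verts = {..<N}, edges = {}\<rparr> :: nat ugraph"
  have "\<not> joined_by_path ?G l u v" if "u \<noteq> v" for u v
  proof
    assume "joined_by_path ?G l u v"
    then obtain p where p: "is_path ?G p" "hd p = u" "last p = v"
      by (auto simp: joined_by_path_def)
    then obtain x xs where "p = x # xs" by (cases p) (auto simp: is_path_def)
    with p that show False by (cases xs) (auto simp: is_path_def)
  qed
  then have "\<not> has_equal_degree_path ?G l" by (auto simp: has_equal_degree_path_def)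
  moreover have "simple_graph ?G" "card (verts ?G) = N" by (auto simp: simple_graph_def)
  ultimately show "S \<noteq> {}" unfolding S_def by blast
qed

end

theory Submission
  imports Defs
begin

text \<open>
  Let \<open>G\<close> have \<open>2 * n + 1\<close> vertices, at least \<open>n\<^sup>2 + n\<close> edges and no path of length five between vertices
  of equal degree. For two vertices \<open>u\<close>, \<open>v\<close> of the same degree \<open>t\<close>, call a vertex \<open>x\<close> a hub if no
  neighbour of \<open>x\<close> other than \<open>u\<close> and \<open>v\<close> has a neighbour, different from \<open>x\<close>, in the link
  \<open>(N(u) \<union> N(v)) - {u, v}\<close>. Any \<open>x\<close> with three common neighbours with \<open>u\<close> (not counting \<open>v\<close>) and three with \<open>v\<close>
  (not counting \<open>u\<close>) is a hub, since a violation \<open>x, y, b\<close> extends to a path \<open>u, a, x, y, b, v\<close>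
  (\<open>hub_if_three_common\<close>); it suffices that \<open>d(x) + t \<ge> 2 * n + 5\<close>, or \<open>d(x) + t \<ge> 2 * n + 2\<close> when \<open>x\<close> is
  adjacent to neither \<open>u\<close> nor \<open>v\<close>. A hub is expensive: link vertices share no neighbours with it except
  \<open>u\<close> and \<open>v\<close> (\<open>link_deg_le\<close>), and the edges that meet neither \<open>u\<close>, \<open>v\<close>, \<open>x\<close> nor a vertex adjacent to
  none of these three lie inside two disjoint sets (\<open>hub_edge_bound\<close>).

  Let \<open>t\<close> be the largest degree that occurs twice; all larger degrees are distinct.

  If \<open>t \<le> n\<close>, let \<open>D\<close> be the maximum degree. The degree sum is at most
  \<open>(2 * n + 1) * t + (D - t) * (D - t + 1) / 2\<close>, and it has to reach \<open>2 * (n\<^sup>2 + n)\<close>. This yields \<open>t \<ge> 5\<close>, which is where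
  \<open>n \<ge> 11\<close> enters, and \<open>D + t \<ge> 2 * n + 5\<close>. So a vertex of degree \<open>D\<close> is a hub, at least \<open>t - 2\<close> link vertices
  have degree at most \<open>2 * n + 3 - D < t\<close>, and the degree sum is too small
  (\<open>no_small_repeated_degree\<close>).

  If \<open>t \<ge> n + 1\<close>, the biclique must appear. When some vertex of degree at least \<open>t\<close> is adjacent to neither
  \<open>u\<close> nor \<open>v\<close>, taking such a non-adjacent vertex of maximal degree as the hub makes the edge bound at most
  \<open>n\<^sup>2 + n\<close>, with equality only for the biclique (\<open>biclique_if_far_large\<close>). This applies to every repeated
  degree above \<open>n\<close>, so in a counterexample vertices of one such degree are nearly pairwise adjacent, and
  four of them already give a path of length five (\<open>large_degree_class_card_le\<close>). With so few vertices in
  every class of large degree, the degree sum forces the largest degree outside \<open>{u, v}\<close> to be at least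
  \<open>2 * n + 5 - t\<close>, hence a hub exists, while the vertices adjacent to neither \<open>u\<close> nor \<open>v\<close> have degree at most
  \<open>n\<close>. The edge bound is then smaller than \<open>n\<^sup>2 + n\<close> (\<open>no_large_repeated_degree\<close>).
\<close>

section \<open>Counting preliminaries\<close>

lemma four_distinct_of_card:
  assumes "4 \<le> card T"
  obtains a b c d where "a \<in> T" "b \<in> T" "c \<in> T" "d \<in> T" "distinct [a, b, c, d]"
proof -
  obtain S where "S \<subseteq> T" "card S = 4"
    using obtain_subset_with_card_n[OF assms] by blast
  moreover have "finite S" using \<open>card S = 4\<close> by (simp add: card_ge_0_finite)
  then obtain xs where "set xs = S" "distinct xs"
    using finite_distinct_list by blast
  moreover have "length xs = 4" using calculation distinct_card by fastforce
  then obtain a b c d where "xs = [a, b, c, d]"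
    by (auto simp: numeral_eq_Suc length_Suc_conv)
  ultimately show thesis using that by auto
qed

lemma sum_le_gauss_if_distinct_positive:
  fixes f :: "'b \<Rightarrow> nat"
  assumes "finite Z" "\<And>v. v \<in> Z \<Longrightarrow> f v \<le> h" "inj_on f {v \<in> Z. 0 < f v}"
  shows "2 * sum f Z \<le> h * (h + 1)"
proof -
  have "sum f Z = sum f {v \<in> Z. 0 < f v}"
    using assms(1) by (intro sum.mono_neutral_right) auto
  also have "\<dots> = \<Sum> (f ` {v \<in> Z. 0 < f v})"
    using assms(3) by (simp add: sum.reindex)
  also have "\<dots> \<le> \<Sum> {0..h}"
    using assms(2) by (intro sum_mono2) auto
  finally have "2 * sum f Z \<le> 2 * \<Sum> {0..h}" by simp
  also have "\<dots> = h * (h + 1)" using gauss_sum_from_Suc_0 [of h] double_gauss_sum[of h, where 'a = nat] by simp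
  finally show ?thesis .
qed

section \<open>Neighbourhoods and edge counts\<close>

locale simple_ugraph =
  fixes G :: "'a ugraph"
  assumes simple: "simple_graph G"
begin

abbreviation "V \<equiv> verts G"
abbreviation "E \<equiv> edges G"
abbreviation "dg \<equiv> deg G"

definition nb :: "'a \<Rightarrow> 'a set" where
  "nb v = {w. {v, w} \<in> E}"

lemma finite_V [simp]: "finite V"
  and edge_sub: "e \<in> E \<Longrightarrow> e \<subseteq> V"
  and edge_card: "e \<in> E \<Longrightarrow> card e = 2"
  using simple by (auto simp: simple_graph_def)

lemma finite_E [simp]: "finite E"
  by (rule finite_subset[of _ "Pow V"]) (auto dest: edge_sub)

lemma nb_sub: "nb v \<subseteq> V"
  using edge_sub by (auto simp: nb_def)

lemma finite_nb [simp]: "finite (nb v)"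
  using nb_sub finite_subset finite_V by metis

lemma nb_sym: "w \<in> nb v \<longleftrightarrow> v \<in> nb w"
  by (simp add: nb_def insert_commute)

lemma nb_irrefl [simp]: "v \<notin> nb v"
  using edge_card by (fastforce simp: nb_def)

lemma edge_obtain:
  assumes "e \<in> E"
  obtains a b where "e = {a, b}" "a \<noteq> b" "b \<in> nb a" "a \<in> nb b"
  using edge_card[OF assms] assms by (auto simp: card_2_iff nb_def insert_commute)

lemma deg_eq_card_nb: "dg v = card (nb v)"
proof -
  have "{e \<in> E. v \<in> e} = (\<lambda>w. {v, w}) ` nb v"
  proof (intro equalityI subsetI)
    fix e assume "e \<in> {e \<in> E. v \<in> e}"
    then show "e \<in> (\<lambda>w. {v, w}) ` nb v"
      by (auto elim!: edge_obtain)
  qed (auto simp: nb_def)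
  moreover have "inj_on (\<lambda>w. {v, w}) (nb v)"
    by (auto simp: inj_on_def doubleton_eq_iff)
  ultimately show ?thesis by (simp add: deg_def card_image)
qed

lemma handshake: "(\<Sum>v \<in> V. dg v) = 2 * card E"
proof -
  have "(\<Sum>v \<in> V. card {e \<in> E. v \<in> e}) = (\<Sum>e \<in> E. 2)"
  proof (rule sum_multicount_gen)
    show "\<forall>e\<in>E. card {v \<in> V. v \<in> e} = 2"
    proof
      fix e assume "e \<in> E"
      then have "{v \<in> V. v \<in> e} = e" using edge_sub by auto
      then show "card {v \<in> V. v \<in> e} = 2" using edge_card \<open>e \<in> E\<close> by simp
    qed
  qed auto
  then show ?thesis by (simp add: deg_def)
qed

lemma deg_less_card_V: "v \<in> V \<Longrightarrow> dg v < card V"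
  unfolding deg_eq_card_nb using nb_sub nb_irrefl by (metis finite_V psubsetI psubset_card_mono)

lemma card_edges_touching_pair:
  assumes "u \<noteq> v"
  shows "card {e \<in> E. u \<in> e \<or> v \<in> e} + (if v \<in> nb u then 1 else 0) = dg u + dg v"
proof -
  have "{e \<in> E. u \<in> e \<or> v \<in> e} = {e \<in> E. u \<in> e} \<union> {e \<in> E. v \<in> e}" by auto
  moreover have "{e \<in> E. u \<in> e} \<inter> {e \<in> E. v \<in> e} = (if v \<in> nb u then {{u, v}} else {})"
    using assms by (auto simp: nb_def insert_commute elim!: edge_obtain)
  ultimately show ?thesis
    using card_Un_Int[of "{e \<in> E. u \<in> e}" "{e \<in> E. v \<in> e}"] by (auto simp: deg_def)
qed

lemma card_edges_within_le:
  assumes "finite S"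
  shows "card {e \<in> E. e \<subseteq> S} \<le> card S choose 2"
proof -
  have "card {e \<in> E. e \<subseteq> S} \<le> card {B. B \<subseteq> S \<and> card B = 2}"
    using assms edge_card by (intro card_mono) (auto intro: finite_subset[of _ "Pow S"])
  then show ?thesis using n_subsets[OF assms] by simp
qed

lemma card_edges_touching_le: 
  assumes "finite S" shows "card {e \<in> E. e \<inter> S \<noteq> {}} \<le> (\<Sum>v\<in>S. dg v)"
proof -
  have "{e \<in> E. e \<inter> S \<noteq> {}} = (\<Union>v\<in>S. {e \<in> E. v \<in> e})" by auto
  then show ?thesis using card_UN_le[OF assms, of "\<lambda>v. {e \<in> E. v \<in> e}"] by (simp add: deg_def)
qed

section \<open>Hubs of a pair of vertices\<close>

text \<open>For two vertices of equal degree, every edge count below is organised by the partition of the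
  remaining vertices into those adjacent to at least one of the two (\<open>link\<close>) and those adjacent to
  neither (\<open>far\<close>). In the biclique, with the two vertices on the smaller side, \<open>link\<close> is the larger
  side and \<open>far\<close> is the rest of the smaller one.\<close>

definition link :: "'a \<Rightarrow> 'a \<Rightarrow> 'a set" where
  "link u v = (nb u \<union> nb v) - {u, v}"

definition far :: "'a \<Rightarrow> 'a \<Rightarrow> 'a set" where
  "far u v = V - link u v - {u, v}"

text \<open>The condition that the absence of a path of length five forces on a vertex sharing enough
  neighbours with \<open>u\<close> and with \<open>v\<close>: apart from \<open>x\<close>, no vertex of the link can be reached from \<open>x\<close> in
  two steps whose middle vertex is neither \<open>u\<close> nor \<open>v\<close>.\<close>

definition hub :: "'a \<Rightarrow> 'a \<Rightarrow> 'a \<Rightarrow> bool" where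
  "hub u v x \<longleftrightarrow> x \<in> V \<and> x \<noteq> u \<and> x \<noteq> v \<and> (\<forall>y \<in> nb x - {u, v}. nb y \<inter> link u v \<subseteq> {x})"

lemma hubD: "hub u v x \<Longrightarrow> y \<in> nb x \<Longrightarrow> y \<noteq> u \<Longrightarrow> y \<noteq> v \<Longrightarrow> b \<in> nb y \<Longrightarrow> b \<in> link u v \<Longrightarrow> b = x"
  unfolding hub_def by blast

lemma card_link_ge: "dg u \<le> card (link u v) + (if v \<in> nb u then 1 else 0)"
proof -
  have "nb u - {v} \<subseteq> link u v" "finite (link u v)" by (auto simp: link_def)
  then have "card (nb u - {v}) \<le> card (link u v)" by (rule card_mono[rotated])
  then show ?thesis by (auto simp: deg_eq_card_nb)
qed

text \<open>The neighbourhoods of \<open>y\<close> and of the hub can meet only in \<open>u\<close> and \<open>v\<close>, so a hub of large degree forces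
  every other link vertex to have small degree.\<close>

lemma link_deg_le:
  assumes "hub u v x" "y \<in> link u v" "y \<noteq> x"
  shows "dg y + dg x \<le> card V + 2"
proof -
  have "nb y \<inter> nb x \<subseteq> {u, v}"
    using hubD[OF assms(1), of _ y] assms(2,3) nb_sym by blast
  then have "card (nb y \<inter> nb x) \<le> card {u, v}" by (intro card_mono) auto
  also have "card {u, v} \<le> 2" by (simp add: card_insert_if)
  finally have "card (nb y \<inter> nb x) \<le> 2" .
  moreover have "card (nb y \<union> nb x) \<le> card V" using nb_sub by (intro card_mono) auto
  ultimately show ?thesis
    using card_Un_Int[of "nb y" "nb x"] by (simp add: deg_eq_card_nb)
qed

text \<open>A neighbour \<open>y\<close> of the hub other than \<open>u\<close> and \<open>v\<close> is joined to no link vertex but the hub itself.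
  Hence an edge that avoids \<open>u\<close>, \<open>v\<close>, \<open>x\<close> and the far non-neighbours \<open>W\<close> of \<open>x\<close> cannot have an end in the link and
  at the same time an end in \<open>Y\<close>; it lies inside \<open>W1\<close> or inside \<open>C\<close>. The edges meeting \<open>W\<close> are
  counted by degrees, because the hub property says nothing about edges inside \<open>W\<close>.\<close>

lemma hub_edge_bound:
  assumes "hub u v x" "u \<in> V" "v \<in> V" "u \<noteq> v"
  defines "Y \<equiv> nb x - {u, v}"
  defines "W \<equiv> far u v - Y - {x}" and "W1 \<equiv> far u v \<inter> Y" and "C \<equiv> link u v - Y - {x}"
  shows "card E + (if v \<in> nb u then 1 else 0)
      \<le> (\<Sum>w\<in>W. dg w) + (card W1 choose 2) + (card C choose 2) + card Y + dg u + dg v"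
proof -
  let ?T = "{e \<in> E. u \<in> e \<or> v \<in> e}"
  have fin: "finite W" "finite W1" "finite C" "finite Y"
    by (auto simp: W_def W1_def C_def Y_def far_def link_def)
  (* The edges not caught by W, W1, C or the pair itself are those at the hub. *)
  have "E \<subseteq> {e \<in> E. e \<inter> W \<noteq> {}} \<union> {e \<in> E. e \<subseteq> W1} \<union> {e \<in> E. e \<subseteq> C} \<union> (\<lambda>y. {x, y}) ` Y \<union> ?T"
  proof
    fix e assume e: "e \<in> E"
    obtain a b where ab: "e = {a, b}" "b \<in> nb a" "a \<in> nb b" using e edge_obtain by metis
    have V: "a \<in> V" "b \<in> V" using ab nb_sub by auto
    show "e \<in> {e \<in> E. e \<inter> W \<noteq> {}} \<union> {e \<in> E. e \<subseteq> W1} \<union> {e \<in> E. e \<subseteq> C} \<union> (\<lambda>y. {x, y}) ` Y \<union> ?T"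
    proof (rule ccontr)
      assume neg: "\<not> ?thesis"
      then have *: "a \<notin> W" "b \<notin> W" "u \<noteq> a" "u \<noteq> b" "v \<noteq> a" "v \<noteq> b" using e ab by auto
      have "a \<noteq> x" "b \<noteq> x" using neg ab * by (auto simp: Y_def insert_commute)
      moreover have "a \<in> Y \<Longrightarrow> b \<notin> link u v" "b \<in> Y \<Longrightarrow> a \<notin> link u v"
        using hubD[OF assms(1)] ab \<open>a \<noteq> x\<close> \<open>b \<noteq> x\<close> by (auto simp: Y_def)
      ultimately have "e \<subseteq> W1 \<or> e \<subseteq> C"
        using * V ab(1) unfolding W_def W1_def C_def far_def by blast
      then show False using neg e by auto
    qed
  qed
  then have "card E \<le> card ({e \<in> E. e \<inter> W \<noteq> {}} \<union> {e \<in> E. e \<subseteq> W1} \<union> {e \<in> E. e \<subseteq> C} \<union> (\<lambda>y. {x, y}) ` Y \<union> ?T)"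
    by (intro card_mono) (auto simp: fin)
  also have "\<dots> \<le> card {e \<in> E. e \<inter> W \<noteq> {}} + card {e \<in> E. e \<subseteq> W1} + card {e \<in> E. e \<subseteq> C}
      + card ((\<lambda>y. {x, y}) ` Y) + card ?T"
    by (intro order_trans[OF card_Un_le] add_mono order_refl)
  also have "\<dots> \<le> (\<Sum>w\<in>W. dg w) + (card W1 choose 2) + (card C choose 2) + card Y + card ?T"
    using fin by (intro add_mono card_edges_touching_le card_edges_within_le card_image_le) auto
  finally show ?thesis using card_edges_touching_pair[OF assms(4)] by linarith
qed

text \<open>The cardinalities that turn \<open>hub_edge_bound\<close> into inequalities between numbers.\<close>

lemma hub_cards:
  assumes "hub u v x" "u \<in> V" "v \<in> V" "u \<noteq> v"
  defines "Y \<equiv> nb x - {u, v}"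
  defines "W \<equiv> far u v - Y - {x}" and "W1 \<equiv> far u v \<inter> Y" and "C \<equiv> link u v - Y - {x}"
  shows "card W + card C + card Y + 3 = card V"
    and "card W + card W1 + (if x \<in> far u v then 1 else 0) + card (link u v) + 2 = card V"
    and "dg x \<le> card Y + 2"
    and "card Y \<le> dg x"
    and "x \<in> far u v \<Longrightarrow> card Y = dg x"
proof -
  have x: "x \<in> V" "x \<noteq> u" "x \<noteq> v" using assms(1) by (auto simp: hub_def)
  have fin: "finite W" "finite W1" "finite C" "finite Y" "finite (link u v)"
    by (auto simp: W_def W1_def C_def Y_def far_def link_def)
  have VD: "V = W \<union> C \<union> Y \<union> {x, u, v}"
    using x assms(2,3) nb_sub unfolding W_def C_def Y_def far_def link_def by blast
  have "card V = card (W \<union> C \<union> Y) + card {x, u, v}"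
    by (subst VD, rule card_Un_disjoint) (use fin in \<open>auto simp: W_def C_def Y_def far_def link_def\<close>)
  also have "card {x, u, v} = 3" using x assms(4) by simp
  also have "card (W \<union> C \<union> Y) = card (W \<union> C) + card Y"
    by (rule card_Un_disjoint) (use fin in \<open>auto simp: W_def C_def\<close>)
  also have "card (W \<union> C) = card W + card C"
    by (rule card_Un_disjoint) (use fin in \<open>auto simp: W_def C_def far_def\<close>)
  finally show "card W + card C + card Y + 3 = card V" by simp
  have "V = (W \<union> W1 \<union> (far u v \<inter> {x})) \<union> (link u v \<union> {u, v})"
    using x assms(2,3) nb_sub unfolding W_def W1_def Y_def far_def link_def by blast
  then have "card V = card ((W \<union> W1 \<union> (far u v \<inter> {x})) \<union> (link u v \<union> {u, v}))" by simp
  also have "\<dots> = card (W \<union> W1 \<union> (far u v \<inter> {x})) + card (link u v \<union> {u, v})"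
    by (rule card_Un_disjoint) (use fin in \<open>auto simp: W_def W1_def Y_def far_def\<close>)
  also have "card (link u v \<union> {u, v}) = card (link u v) + card {u, v}"
    by (rule card_Un_disjoint) (use fin in \<open>auto simp: link_def\<close>)
  also have "card {u, v} = 2" using assms(4) by simp
  also have "card (W \<union> W1 \<union> (far u v \<inter> {x})) = card (W \<union> W1) + card (far u v \<inter> {x})"
    by (rule card_Un_disjoint) (use fin in \<open>auto simp: W_def W1_def Y_def\<close>)
  also have "card (W \<union> W1) = card W + card W1"
    by (rule card_Un_disjoint) (use fin in \<open>auto simp: W_def W1_def\<close>)
  also have "card (far u v \<inter> {x}) = (if x \<in> far u v then 1 else 0)" by auto
  finally show "card W + card W1 + (if x \<in> far u v then 1 else 0) + card (link u v) + 2 = card V"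
    by simp
  have "card (nb x) \<le> card (Y \<union> {u, v})" by (intro card_mono) (auto simp: Y_def)
  also have "\<dots> \<le> card Y + card {u, v}" by (rule card_Un_le)
  finally show "dg x \<le> card Y + 2" using assms(4) by (simp add: deg_eq_card_nb)
  show "card Y \<le> dg x" unfolding Y_def deg_eq_card_nb by (intro card_mono) auto
  show "card Y = dg x" if "x \<in> far u v"
  proof -
    have "Y = nb x" using that x nb_sym by (auto simp: Y_def far_def link_def)
    then show ?thesis by (simp add: deg_eq_card_nb)
  qed
qed

end

section \<open>Hubs from the absence of paths of length five\<close>

locale no_path_graph = simple_ugraph +
  assumes no_path: "\<not> has_equal_degree_path G 5"
begin

lemma no_equal_degree_path5:
  assumes "dg a = dg f" "distinct [a, b, c, d, e, f]"
    and "b \<in> nb a" "c \<in> nb b" "d \<in> nb c" "e \<in> nb d" "f \<in> nb e"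
  shows False
proof -
  have "a \<in> V" "f \<in> V" using assms nb_sub nb_sym by blast+
  moreover have "is_path G [a, b, c, d, e, f]"
    using assms nb_sub nb_sym[of _ a] edge_sub by (auto simp: is_path_def nb_def)
  then have "joined_by_path G 5 a f"
    unfolding joined_by_path_def by (intro exI[of _ "[a, b, c, d, e, f]"]) auto
  ultimately have "has_equal_degree_path G 5"
    using assms(1,2) unfolding has_equal_degree_path_def by fastforce
  with no_path show False by simp
qed

text \<open>Adjacency may be given in either orientation; this is the form in which concrete paths are
  refuted.\<close>

lemma no_equal_degree_path5':
  assumes "dg a = dg f" "distinct [a, b, c, d, e, f]"
    and "b \<in> nb a \<or> a \<in> nb b" "c \<in> nb b \<or> b \<in> nb c" "d \<in> nb c \<or> c \<in> nb d"
      "e \<in> nb d \<or> d \<in> nb e" "f \<in> nb e \<or> e \<in> nb f"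
  shows False
  using no_equal_degree_path5[of a f b c d e] assms nb_sym by metis

text \<open>Let \<open>y\<close> be a neighbour of \<open>x\<close> and \<open>b\<close> a neighbour of \<open>y\<close>, with \<open>b\<close> adjacent to \<open>v\<close>, say. One of the three common
  neighbours of \<open>x\<close> and \<open>u\<close>, call it \<open>a\<close>, differs from \<open>y\<close> and \<open>b\<close>, and \<open>u, a, x, y, b, v\<close> is a forbidden
  path.\<close>

lemma hub_if_three_common:
  assumes "u \<noteq> v" "dg u = dg v" "x \<in> V" "x \<noteq> u" "x \<noteq> v"
    and "3 \<le> card (nb x \<inter> nb u - {v})" "3 \<le> card (nb x \<inter> nb v - {u})"
  shows "hub u v x"
proof -
  have pick: "\<exists>a \<in> S. a \<noteq> y \<and> a \<noteq> b" if "3 \<le> card S" for S :: "'a set" and y b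
  proof (rule ccontr)
    assume "\<not> ?thesis"
    then have "S \<subseteq> {y, b}" by auto
    then have "card S \<le> card {y, b}" by (intro card_mono) auto
    also have "\<dots> \<le> 2" by (simp add: card_insert_if)
    finally show False using that by simp
  qed
  have "b = x" if y: "y \<in> nb x" "y \<noteq> u" "y \<noteq> v" and b: "b \<in> nb y" "b \<in> link u v" for y b
  proof (rule ccontr)
    assume "b \<noteq> x"
    have bl: "b \<noteq> u" "b \<noteq> v" "b \<noteq> y" "y \<noteq> x" using b y by (auto simp: link_def)
    consider "b \<in> nb v" | "b \<in> nb u" using b by (auto simp: link_def)
    then show False
    proof cases
      case 1
      obtain a where "a \<in> nb x \<inter> nb u - {v}" "a \<noteq> y" "a \<noteq> b" using pick[OF assms(6)] by blast
      then show False
        using no_equal_degree_path5[of u v a x y b] 1 y b bl \<open>b \<noteq> x\<close> assms(1-5) nb_sym by (metis DiffE IntE distinct_length_2_or_more distinct_singleton nb_irrefl singletonI)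
    next
      case 2
      obtain a where "a \<in> nb x \<inter> nb v - {u}" "a \<noteq> y" "a \<noteq> b" using pick[OF assms(7)] by blast
      then show False
        using no_equal_degree_path5[of u v b y x a] 2 y b bl \<open>b \<noteq> x\<close> assms(1-5) nb_sym by (metis DiffE IntE distinct_length_2_or_more distinct_singleton nb_irrefl singletonI)
    qed
  qed
  then show ?thesis using assms unfolding hub_def by blast
qed

text \<open>Inclusion-exclusion gives four common neighbours of \<open>x\<close> with each of \<open>u\<close> and \<open>v\<close>; one of them may be the
  other vertex of the pair.\<close>

lemma hub_if_large_degrees:
  assumes "u \<noteq> v" "dg u = dg v" "x \<in> V" "x \<noteq> u" "x \<noteq> v" "card V + 4 \<le> dg x + dg u"
  shows "hub u v x"
proof -
  have "3 \<le> card (nb x \<inter> nb w - {w'})" if "dg w = dg u" for w w'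
  proof -
    have "card (nb x \<union> nb w) \<le> card V" using nb_sub by (intro card_mono) auto
    then have "4 \<le> card (nb x \<inter> nb w)"
      using card_Un_Int[of "nb x" "nb w"] assms(6) that by (simp add: deg_eq_card_nb)
    then show ?thesis using card_Diff1_le by (auto simp: card_Diff_singleton_if)
  qed
  then show ?thesis using hub_if_three_common assms by metis
qed

text \<open>For a far vertex a smaller degree sum suffices: neither \<open>x\<close> nor \<open>u\<close> lies in the union of their
  neighbourhoods, and \<open>v\<close> is not a common neighbour.\<close>

lemma hub_if_far:
  assumes "u \<noteq> v" "dg u = dg v" "x \<in> far u v" "u \<in> V" "v \<in> V" "card V + 1 \<le> dg x + dg u"
  shows "hub u v x"
proof -
  have x: "x \<in> V" "x \<noteq> u" "x \<noteq> v" "x \<notin> nb u" "x \<notin> nb v" using assms by (auto simp: far_def link_def)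
  have "3 \<le> card (nb x \<inter> nb w - {w'})" if "w \<in> {u, v}" "w' \<in> {u, v}" for w w'
  proof -
    have "nb x \<union> nb w \<subseteq> V - {x, w}" using nb_sub x that nb_sym by auto
    then have "card (nb x \<union> nb w) \<le> card (V - {x, w})" by (intro card_mono) auto
    also have "\<dots> = card V - 2"
      using x assms that by (subst card_Diff_subset) (auto simp: card_insert_if)
    finally have "card (nb x \<union> nb w) \<le> card V - 2" .
    moreover have "2 \<le> card V" using card_mono[of V "{u, v}"] assms by simp
    ultimately have "3 \<le> card (nb x \<inter> nb w)"
      using card_Un_Int[of "nb x" "nb w"] assms that by (auto simp: deg_eq_card_nb)
    moreover have "nb x \<inter> nb w - {w'} = nb x \<inter> nb w" using x that nb_sym by auto
    ultimately show ?thesis by simp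
  qed
  then show ?thesis using hub_if_three_common assms x by auto
qed

end

section \<open>Integer inequalities behind the edge counts\<close>

text \<open>The arithmetic of \<open>hub_edge_bound\<close> for a hub of degree \<open>d\<close> taken among the far vertices, where
  \<open>p\<close>, \<open>a\<close>, \<open>b\<close>, \<open>c\<close> are the sizes of \<open>W\<close>, \<open>W1\<close>, \<open>C\<close> and the link, \<open>s\<close> is the degree sum over \<open>W\<close>,
  \<open>t\<close> is the repeated degree and \<open>\<epsilon>\<close> records whether the pair is adjacent. The bound reaches \<open>n\<^sup>2 + n\<close> only
  in two configurations: \<open>\<epsilon> = 0\<close> is the biclique, \<open>\<epsilon> = 1\<close> is the biclique with an additional edge on its smaller
  side, where up to one unit of \<open>s\<close> may be missing.\<close>

lemma far_hub_count:
  fixes n t d p b a c s e \<epsilon> :: int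
  assumes eps: "\<epsilon> = 0 \<or> \<epsilon> = 1" and t: "n + 1 \<le> t" and d: "n + 1 \<le> d"
    and pb: "p + b = 2 * n - 2 - d" and pa: "p + a = 2 * n - 2 - c" and c: "t \<le> c + \<epsilon>"
    and nonneg: "0 \<le> p" "0 \<le> a" "0 \<le> b" and s: "s \<le> p * d" and e: "n\<^sup>2 + n \<le> e"
    and bound: "2 * e + 2 * \<epsilon> \<le> 2 * s + a * (a - 1) + b * (b - 1) + 2 * d + 4 * t"
  shows "a = 0 \<and> b = 0 \<and> d = n + 1 \<and> t = n + 1 + \<epsilon> \<and> p * d - \<epsilon> \<le> s"
proof -
  (* w is the largest value of a that the link size permits; with n, d and t eliminated, twice
     the surplus of the bound over n^2 + n is at most a polynomial in b, z, w and the adjacency indicator. *)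
  define z where "z = d - n"
  define w where "w = b + d - t + \<epsilon>"
  have z: "1 \<le> z" and dz: "d = n + z" and n: "n = p + b + 2 + z" and tw: "t = n + b + z + \<epsilon> - w"
    using d pb by (auto simp: z_def w_def)
  have aw: "a \<le> w" using pa pb c by (auto simp: w_def)
  have "a * (a - 1) \<le> w * (w - 1)"
  proof (cases "a = 0")
    case True then show ?thesis using aw nonneg by (cases "w = 0") (auto intro: mult_nonneg_nonneg)
  next
    case False then show ?thesis using aw nonneg by (intro mult_mono) auto
  qed
  then have key0: "0 \<le> 2 * (s - p * d) + (2 * z - 2 * (z * z) + 2 * \<epsilon> - 2 * (b * p) - b * b - b - 4 * (b * z) + w * (w - 5))"
    using bound e unfolding tw dz n by (simp add: algebra_simps power2_eq_square)
  have "0 \<le> b * p" using nonneg by simp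
  then have key: "0 \<le> 2 * z - 2 * (z * z) + 2 * \<epsilon> - b * b - b - 4 * (b * z) + w * (w - 5)"
    using key0 s by (simp add: algebra_simps)
  have zz: "z \<le> z * z" and bz: "b \<le> b * z" "0 \<le> b * b"
    using z nonneg mult_left_mono[of 1 z z] mult_left_mono[of 1 z b] by auto
  have m: "w \<le> b + z + \<epsilon> - 1" using t tw by linarith
  have w0: "w = 0"
  proof (rule ccontr)
    assume "w \<noteq> 0"
    then have "1 \<le> w" using aw nonneg by linarith
    (* w * (w - 5) is negative for 1 <= w <= 4 and increasing from w = 5 on. *)
    consider "w \<in> {1, 2, 3, 4}" | "5 \<le> w" using \<open>1 \<le> w\<close> by force
    then show False
    proof cases
      case 1
      then have "w * (w - 5) \<le> - 4" by auto
      then show False using key eps zz bz nonneg by linarith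
    next
      case 2
      then have "w * (w - 5) \<le> (b + z + \<epsilon> - 1) * (b + z + \<epsilon> - 1 - 5)"
        using m by (intro mult_mono) auto
      moreover from eps have "(b + z + \<epsilon> - 1) * (b + z + \<epsilon> - 1 - 5)
          < 2 * (z * z) - 2 * z - 2 * \<epsilon> + b * b + b + 4 * (b * z)"
      proof
        assume "\<epsilon> = 0"
        then have "(b + z + \<epsilon> - 1) * (b + z + \<epsilon> - 1 - 5) = b * b + 2 * (b * z) + z * z - 7 * b - 7 * z + 6"
          by (simp add: algebra_simps)
        then show ?thesis using \<open>\<epsilon> = 0\<close> 2 m zz bz nonneg z by linarith
      next
        assume "\<epsilon> = 1"
        then have "(b + z + \<epsilon> - 1) * (b + z + \<epsilon> - 1 - 5) = b * b + 2 * (b * z) + z * z - 5 * b - 5 * z"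
          by (simp add: algebra_simps)
        then show ?thesis using \<open>\<epsilon> = 1\<close> 2 m zz bz nonneg z by linarith
      qed
      ultimately show False using key by linarith
    qed
  qed
  have z1: "z = 1"
  proof (rule ccontr)
    assume "z \<noteq> 1"
    then have "2 * z \<le> z * z" using z by (intro mult_right_mono) auto
    moreover have "w * (w - 5) = 0" using w0 by simp
    ultimately show False using key eps bz z nonneg \<open>z \<noteq> 1\<close> by linarith
  qed
  moreover have b0: "b = 0"
  proof -
    have "5 * b \<le> 2" using key eps bz(2) unfolding z1 w0 by linarith
    then show ?thesis using nonneg by linarith
  qed
  moreover have "a = 0" using aw w0 nonneg by simp
  moreover have "p * d - \<epsilon> \<le> s"
    using key0 unfolding w0 b0 z1 by simp
  ultimately show ?thesis using tw dz w0 by auto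
qed

text \<open>The corresponding arithmetic when all far vertices have degree at most \<open>n\<close>: here \<open>n + y\<close> is the
  repeated degree, \<open>n + z\<close> the degree of the hub, and \<open>p\<close>, \<open>a\<close>, \<open>b\<close> are again the sizes of \<open>W\<close>, \<open>W1\<close>, \<open>C\<close>. The condition
  \<open>5 \<le> y + z\<close> is the one under which \<open>x\<close> is known to be a hub.\<close>

lemma near_hub_count:
  fixes n y z a b p :: int
  assumes n: "11 \<le> n" and yz: "0 \<le> y" "0 \<le> z" "5 \<le> y + z"
    and p: "0 \<le> p" and a: "0 \<le> a" "a \<le> n - y - p" and b: "0 \<le> b" "b \<le> n - z - p"
  shows "2 * (n * p) + a * (a - 1) + b * (b - 1) + 6 * n + 4 * y + 2 * z < 2 * n\<^sup>2 + 2 * n"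
proof -
  define s where "s = n - p"
  have sn: "s \<le> n" "y \<le> s" "z \<le> s" "a \<le> s - y" "b \<le> s - z" using p a b by (auto simp: s_def)
  have tri: "k * (k - 1) \<le> l * (l - 1)" if "0 \<le> k" "k \<le> l" for k l :: int
  proof (cases "k = 0")
    case True then show ?thesis using that by (cases "l = 0") (auto intro: mult_nonneg_nonneg)
  next
    case False then show ?thesis using that by (intro mult_mono) auto
  qed
  have ab: "a * (a - 1) \<le> (s - y) * (s - y - 1)" "b * (b - 1) \<le> (s - z) * (s - z - 1)"
    using tri sn a b by auto
  have main: "(s - y) * (s - y - 1) + (s - z) * (s - z - 1) + 4 * n + 4 * y + 2 * z < 2 * (n * s)"
  proof -
    consider "s = 3" | "s = 4" | "5 \<le> s" using yz sn by linarith
    then show ?thesis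
    proof cases
      case 1
      then have "y \<in> {0, 1, 2, 3}" "z \<in> {0, 1, 2, 3}" using yz sn by auto
      then show ?thesis using 1 n yz by auto
    next
      case 2
      then have "y \<in> {0, 1, 2, 3, 4}" "z \<in> {0, 1, 2, 3, 4}" using yz sn by auto
      then show ?thesis using 2 n yz by auto
    next
      case 3
      have "y * y \<le> s * y" "z * z \<le> s * z" using yz sn by (auto intro: mult_right_mono)
      moreover have "5 * (s - 5) \<le> (y + z) * (s - 5)" using yz 3 by (intro mult_right_mono) auto
      moreover have "25 - 7 * s + 2 * (s * s) + 4 * n < 2 * (n * s)"
      proof -
        have "(n - s) * 3 \<le> (n - s) * (s - 2)" using 3 sn by (intro mult_left_mono) auto
        moreover have "25 - 3 * s < 6 * (n - s)" using sn(1) n by simp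
        ultimately show ?thesis by (simp add: algebra_simps)
      qed
      ultimately show ?thesis using yz by (simp add: algebra_simps)
    qed
  qed
  have "n * p = n * n - n * s" by (simp add: s_def algebra_simps)
  then show ?thesis using main ab unfolding power2_eq_square by linarith
qed

text \<open>Here \<open>d\<close> is the maximum degree and \<open>t\<close> the largest repeated one. Bounding \<open>d\<close> by \<open>2 * n\<close> first yields
  \<open>t * (t + 1) \<ge> 2 * n\<close>; since \<open>2 * n \<ge> 22\<close> exceeds \<open>4 * 5\<close>, this gives \<open>t \<ge> 5\<close>. It is here that the value 11
  is decisive.\<close>

lemma repeated_arith_lower:
  fixes n t d :: int
  assumes "11 \<le> n" "0 \<le> t" "t \<le> n" "t \<le> d" "d \<le> 2 * n"
    and sum: "4 * n\<^sup>2 + 4 * n \<le> 2 * ((2 * n + 1) * t) + (d - t) * (d - t + 1)"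
  shows "2 * n + 5 \<le> d + t"
proof (rule ccontr)
  assume neg: "\<not> ?thesis"
  have "5 \<le> t"
  proof (rule ccontr)
    assume "\<not> 5 \<le> t"
    then have "t \<in> {0, 1, 2, 3, 4}" using assms by auto
    moreover have "(d - t) * (d - t + 1) \<le> (2 * n - t) * (2 * n - t + 1)"
      using assms by (intro mult_mono) auto
    ultimately show False using sum assms(1) by (auto simp: algebra_simps power2_eq_square)
  qed
  define m where "m = n - t"
  have m: "0 \<le> m" "m + 5 \<le> n" "t = n - m" using assms \<open>5 \<le> t\<close> by (auto simp: m_def)
  have "(d - t) * (d - t + 1) \<le> (2 * m + 4) * (2 * m + 5)"
    using neg assms by (intro mult_mono) (auto simp: m_def)
  moreover have "m * (m + 5) \<le> m * n" using m by (intro mult_left_mono) auto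
  ultimately show False using sum assms(1) m unfolding m(3) by (simp add: algebra_simps power2_eq_square)
qed

text \<open>The summand \<open>2 * ((t - 2) * (d + t - (2 * n + 3)))\<close> is what the hub gains: \<open>t - 2\<close> link
  vertices miss the degree \<open>t\<close> by at least \<open>d + t - (2 * n + 3)\<close>.\<close>

lemma repeated_arith_contra:
  fixes n t d :: int
  assumes n: "11 \<le> n" and t: "t \<le> n" and d: "d \<le> 2 * n" "2 * n + 5 \<le> d + t"
    and sum: "4 * n\<^sup>2 + 4 * n + 2 * ((t - 2) * (d + t - (2 * n + 3)))
      \<le> 2 * ((2 * n + 1) * t) + (d - t) * (d - t + 1)"
  shows False
proof -
  define r h where "r = 2 * n - d" and "h = d + t - 2 * n"
  have rh: "d = 2 * n - r" "t = r + h" "0 \<le> r" "5 \<le> h" using d by (auto simp: r_def h_def)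
  have "0 \<le> r * (n - t)" "0 \<le> r * (h - 3)" using rh t by auto
  (* The quadratic h^2 - 11 h + 12 that remains is at least -18, which 2 n >= 22 outweighs. *)
  moreover have "0 \<le> (h - 5) * (h - 6)"
    using rh(4) by (cases "h = 5") auto
  ultimately show False using sum n unfolding rh(1,2) by (simp add: algebra_simps power2_eq_square)
qed

lemma choose_two_int: "2 * int (k choose 2) = int k * (int k - 1)"
  by (induction k) (auto simp: numeral_2_eq_2 algebra_simps)

section \<open>The far vertices of a pair of large degree\<close>

text \<open>The isomorphism class of \<open>complete_bipartite k l\<close>, described inside the graph so that no bijection
  has to be carried through the argument.\<close>

definition spanning_biclique :: "'a ugraph \<Rightarrow> nat \<Rightarrow> nat \<Rightarrow> bool" where
  "spanning_biclique G k l \<longleftrightarrow> (\<exists>X Z. X \<inter> Z = {} \<and> verts G = X \<union> Z \<and> card X = k \<and> card Z = l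
     \<and> edges G = {{x, z} |x z. x \<in> X \<and> z \<in> Z})"

locale dense_graph = no_path_graph +
  fixes n :: nat
  assumes card_V: "card V = 2 * n + 1" and dense: "n\<^sup>2 + n \<le> card E" and n_ge: "11 \<le> n"
begin

text \<open>A far vertex and the pair both of degree at least \<open>n + 1\<close> make that vertex a hub. Taking one of
  maximal degree bounds all degrees in \<open>W\<close>, so \<open>far_hub_count\<close> applies and determines the
  graph almost completely.\<close>

lemma far_hub_tight:
  assumes uv: "u \<in> V" "v \<in> V" "u \<noteq> v" "dg u = dg v" "n + 1 \<le> dg u"
    and x: "x \<in> far u v" "n + 1 \<le> dg x" "\<And>w. w \<in> far u v \<Longrightarrow> dg w \<le> dg x"
  defines "\<epsilon> \<equiv> (if v \<in> nb u then 1 else 0)"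
  shows "dg x = n + 1 \<and> dg u = n + 1 + \<epsilon> \<and> far u v \<inter> nb x = {} \<and> link u v \<subseteq> nb x \<and> card (link u v) = n + 1
    \<and> (n - 3) * (n + 1) \<le> (\<Sum>w\<in>far u v - {x}. dg w) + \<epsilon>"
proof -
  define Y W W1 C where defs: "Y = nb x - {u, v}" "W = far u v - Y - {x}" "W1 = far u v \<inter> Y" "C = link u v - Y - {x}"
  have hub: "hub u v x" using uv x card_V by (intro hub_if_far) auto
  note cards = hub_cards[OF hub uv(1-3), folded defs(1), folded defs(2-4)]
  note bound = hub_edge_bound[OF hub uv(1-3), folded defs(1), folded defs(2-4)]
  define s where "s = (\<Sum>w\<in>W. dg w)"
  have "s \<le> (\<Sum>w\<in>W. dg x)" unfolding s_def using x(3) by (intro sum_mono) (auto simp: defs)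
  then have s: "int s \<le> int (card W) * int (dg x)" by (simp flip: of_nat_mult)
  have Yx: "card Y = dg x" using cards(5) x(1) .
  have fin: "finite W1" "finite C" by (auto simp: defs far_def link_def)
  have "int (card W1) = 0 \<and> int (card C) = 0 \<and> int (dg x) = int n + 1 \<and> int (dg u) = int n + 1 + int \<epsilon> \<and>
      int (card W) * int (dg x) - int \<epsilon> \<le> int s"
  proof (rule far_hub_count[where c = "int (card (link u v))" and e = "int (card E)"])
    show "2 * int (card E) + 2 * int \<epsilon>
      \<le> 2 * int s + int (card W1) * (int (card W1) - 1) + int (card C) * (int (card C) - 1) + 2 * int (dg x) + 4 * int (dg u)"
    proof -
      have "card E + \<epsilon> \<le> s + (card W1 choose 2) + (card C choose 2) + dg x + 2 * dg u"
        using bound unfolding Yx uv(4) \<epsilon>_def s_def by linarith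
      then show ?thesis unfolding choose_two_int[symmetric] by linarith
    qed
    show "(int n)\<^sup>2 + int n \<le> int (card E)" using dense by (simp flip: of_nat_power of_nat_add)
    show "int (dg u) \<le> int (card (link u v)) + int \<epsilon>" using card_link_ge[of u v] by (auto simp: \<epsilon>_def)
  qed (use s cards card_V Yx uv x in \<open>auto simp: \<epsilon>_def\<close>)
  then have res: "card W1 = 0" "card C = 0" "dg x = n + 1" "dg u = n + 1 + \<epsilon>"
    and "int (card W * dg x) \<le> int (s + \<epsilon>)"
    by auto
  then have res_sum: "card W * (n + 1) \<le> s + \<epsilon>" unfolding of_nat_le_iff by simp
  have W1: "W1 = {}" and C: "C = {}" using res fin by auto
  have xn: "x \<notin> link u v" "u \<notin> nb x" "v \<notin> nb x" using x(1) nb_sym by (auto simp: far_def link_def)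
  have "far u v \<inter> nb x = {}" using W1 by (auto simp: defs far_def)
  moreover have "link u v \<subseteq> nb x" using C xn by (auto simp: defs)
  moreover have "W = far u v - {x}" using calculation by (auto simp: defs)
  moreover have "card W = n - 3" using cards(1) card_V res Yx by simp
  moreover have "card (link u v) = n + 1" using cards(2) x(1) res card_V calculation n_ge by simp
  ultimately show ?thesis using res res_sum s_def by simp
qed

lemma exists_max_degree:
  assumes "S \<subseteq> V" "S \<noteq> {}"
  obtains x where "x \<in> S" "\<And>w. w \<in> S \<Longrightarrow> dg w \<le> dg x"
proof -
  have "finite S" using assms finite_subset finite_V by metis
  then have "Max (dg ` S) \<in> dg ` S" using assms by (intro Max_in) auto
  then obtain x where "x \<in> S" "dg x = Max (dg ` S)" by auto
  then show thesis using that \<open>finite S\<close> by simp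
qed

text \<open>A far vertex of degree at least that of the pair rules out the adjacent configuration of
  \<open>far_hub_tight\<close>, because there the pair has degree \<open>n + 2\<close> and the far vertices at most \<open>n + 1\<close>. In the
  other one all far vertices have degree \<open>n + 1\<close> and are therefore hubs themselves. This makes both sides
  independent, and the number of edges leaves no room for a missing one.\<close>

lemma biclique_if_far_large:
  assumes uv: "u \<in> V" "v \<in> V" "u \<noteq> v" "dg u = dg v" "n + 1 \<le> dg u"
    and y: "y \<in> far u v" "dg u \<le> dg y"
  shows "spanning_biclique G n (n + 1)"
proof -
  obtain x where x: "x \<in> far u v" "\<And>w. w \<in> far u v \<Longrightarrow> dg w \<le> dg x"
    using exists_max_degree[of "far u v"] y by (auto simp: far_def)
  have "n + 1 \<le> dg x" using x y uv by fastforce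
  note tight = far_hub_tight[OF uv x(1) this x(2)]
  have uvn: "v \<notin> nb u" using tight x(2)[OF y(1)] y(2) by (auto split: if_splits)
  have du: "dg u = n + 1" "dg x = n + 1" using tight uvn by auto
  let ?X = "far u v \<union> {u, v}" and ?Z = "link u v"
  have VXZ: "V = ?X \<union> ?Z" "?X \<inter> ?Z = {}" using uv nb_sub by (auto simp: far_def link_def)
  have finX: "finite ?X" "finite ?Z" by (auto simp: far_def link_def)
  have cZ: "card ?Z = n + 1" using tight by simp
  then have cX: "card ?X = n" using card_Un_disjoint[OF finX VXZ(2)] card_V VXZ(1) by simp
  have cf: "card (far u v) = n - 2"
  proof -
    have "card ?X = card (far u v) + card {u, v}"
      by (rule card_Un_disjoint) (auto simp: far_def)
    then show ?thesis using cX uv by simp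
  qed
  have far_deg: "dg a = n + 1" if a: "a \<in> far u v" for a
  proof (rule ccontr)
    assume "dg a \<noteq> n + 1"
    then have a': "a \<in> far u v - {x}" "dg a < n + 1" using a du x(2)[OF a] by auto
    have "(\<Sum>w\<in>far u v - {x}. dg w) < (\<Sum>w\<in>far u v - {x}. n + 1)"
      using a' x(2) du by (intro sum_strict_mono_ex1) (auto simp: far_def)
    also have "\<dots> = (n - 3) * (n + 1)" using x(1) cf by (simp add: card_Diff_singleton)
    finally show False using tight uvn by (simp del: mult_Suc_right)
  qed
  have far_nb: "u \<notin> nb a" "v \<notin> nb a" if "a \<in> far u v" for a
    using that nb_sym by (auto simp: far_def link_def)
  have indepX: "w' \<notin> ?X" if w: "w \<in> ?X" "w' \<in> nb w" for w w'
  proof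
    assume w': "w' \<in> ?X"
    have ww: "w \<in> far u v" "w' \<in> far u v" using w w' uvn far_nb nb_sym by auto
    have "hub u v w" using ww uv du card_V far_deg by (intro hub_if_far) auto
    then have "nb w' \<inter> link u v \<subseteq> {w}" using w ww by (auto simp: far_def dest: hubD)
    then have "nb w' \<subseteq> far u v"
      using far_nb[OF ww(2)] nb_sub ww(1) unfolding far_def by blast
    then have "dg w' \<le> card (far u v)"
      unfolding deg_eq_card_nb by (intro card_mono) (auto simp: far_def)
    then show False using far_deg[OF ww(2)] cf by simp
  qed
  have hubx: "hub u v x" using x(1) uv du card_V by (intro hub_if_far) auto
  have indepZ: "w' \<notin> ?Z" if w: "w \<in> ?Z" "w' \<in> nb w" for w w'
  proof -
    have "w \<in> nb x" "w \<noteq> u" "w \<noteq> v" using tight w(1) by (auto simp: link_def)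
    then show ?thesis using hubD[OF hubx _ _ _ w(2)] x(1) by (auto simp: far_def)
  qed
  let ?K = "(\<lambda>(a, b). {a, b}) ` (?X \<times> ?Z)"
  have "E \<subseteq> ?K"
  proof
    fix e assume "e \<in> E"
    then obtain a b where ab: "e = {a, b}" "b \<in> nb a" "a \<in> nb b" using edge_obtain by metis
    then have "a \<in> V" "b \<in> V" using nb_sub by auto
    then have "a \<in> ?X \<and> b \<in> ?Z \<or> b \<in> ?X \<and> a \<in> ?Z" 
      using ab VXZ(1) indepX[of a b] indepZ[of a b] by blast
    then show "e \<in> ?K" using ab(1) by (auto simp: insert_commute)
  qed
  moreover have "card ?K \<le> card E"
  proof -
    have "card ?K \<le> card (?X \<times> ?Z)" using finX by (intro card_image_le) auto
    also have "\<dots> = n\<^sup>2 + n" using cX cZ by (simp add: card_cartesian_product power2_eq_square)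
    finally show ?thesis using dense by simp
  qed
  ultimately have "E = ?K" using finX by (intro card_seteq) auto
  then have "E = {{a, b} |a b. a \<in> ?X \<and> b \<in> ?Z}" by auto
  then show ?thesis
    unfolding spanning_biclique_def using VXZ cX cZ by (intro exI[of _ ?X] exI[of _ ?Z]) auto
qed

section \<open>Few vertices share a large degree\<close>

text \<open>Otherwise the three neighbourhoods, each with at least \<open>n + 2 - card F\<close> vertices outside \<open>F\<close>, would be
  pairwise disjoint there and exceed the \<open>2 * n + 1 - card F\<close> vertices available.\<close>

lemma common_neighbour_outside:
  assumes F: "F \<subseteq> V" "card F \<le> 5" and abc: "a \<in> F" "b \<in> F" "c \<in> F"
    and deg: "n + 1 \<le> dg a" "n + 1 \<le> dg b" "n + 1 \<le> dg c"
  shows "\<exists>z. z \<notin> F \<and> (z \<in> nb a \<inter> nb b \<or> z \<in> nb a \<inter> nb c \<or> z \<in> nb b \<inter> nb c)"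
proof (rule ccontr)
  assume no: "\<not> ?thesis"
  have finF: "finite F" by (rule finite_subset[OF F(1) finite_V])
  have dis: "z \<notin> nb a \<or> z \<notin> nb b" "z \<notin> nb a \<or> z \<notin> nb c" "z \<notin> nb b \<or> z \<notin> nb c" if "z \<notin> F" for z
    using no that by blast+
  have big: "n + 2 \<le> card (nb w - F) + card F" if "w \<in> F" "n + 1 \<le> dg w" for w
  proof -
    have "nb w \<subseteq> (nb w - F) \<union> (F - {w})" by auto
    then have "card (nb w) \<le> card ((nb w - F) \<union> (F - {w}))" by (rule card_mono[rotated]) (simp add: finF)
    then have "dg w \<le> card (nb w - F) + card (F - {w})"
      unfolding deg_eq_card_nb using card_Un_le by (rule order_trans)
    moreover have "card F = Suc (card (F - {w}))" using finF that(1) by (rule card.remove)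
    ultimately show ?thesis using that(2) by linarith
  qed
  let ?A = "nb a - F" and ?B = "nb b - F" and ?C = "nb c - F"
  have "card (?A \<union> ?B \<union> ?C) = card ?A + card ?B + card ?C"
  proof -
    have "card (?A \<union> ?B \<union> ?C) = card (?A \<union> ?B) + card ?C"
      by (rule card_Un_disjoint) (use dis in \<open>auto\<close>)
    moreover have "card (?A \<union> ?B) = card ?A + card ?B"
      by (rule card_Un_disjoint) (use dis in \<open>auto\<close>)
    ultimately show ?thesis by simp
  qed
  moreover have "card (?A \<union> ?B \<union> ?C) \<le> card (V - F)" using nb_sub by (intro card_mono) auto
  moreover have "card (V - F) = 2 * n + 1 - card F" using card_Diff_subset[OF finF F(1)] card_V by simp
  moreover have "card F \<le> 2 * n + 1" using F n_ge by simp
  ultimately show False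
    using big[OF abc(1) deg(1)] big[OF abc(2) deg(2)] big[OF abc(3) deg(3)] F(2) n_ge by linarith
qed

text \<open>The four vertices are put in a row in which one step is an edge and the other two are detours through
  common neighbours outside; this is a path of length five. One detour, \<open>p, z, q\<close>, is given.
  Applying \<open>common_neighbour_outside\<close> to \<open>p\<close>, \<open>r\<close>, \<open>s\<close> with \<open>z\<close> forbidden yields a
  second one, between a different pair, and the adjacency assumption provides the edge.\<close>

lemma no_four_nearly_adjacent:
  assumes dist: "distinct [p, q, r, s]" and V: "{p, q, r, s} \<subseteq> V"
    and deg: "\<And>w. w \<in> {p, q, r, s} \<Longrightarrow> dg w = d" and d: "n + 1 \<le> d"
    and adj: "\<And>a b c. {a, b, c} \<subseteq> {p, q, r, s} \<Longrightarrow> distinct [a, b, c] \<Longrightarrow> c \<in> nb a \<or> c \<in> nb b"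
    and z: "z \<in> nb p \<inter> nb q" "z \<notin> {p, q, r, s}"
  shows False
proof -
  have cF: "card {p, q, r, s, z} = 5" using dist z by auto
  have "z \<in> V" using z nb_sub by auto
  then obtain z' where z': "z' \<notin> {p, q, r, s, z}"
    "z' \<in> nb p \<inter> nb r \<or> z' \<in> nb p \<inter> nb s \<or> z' \<in> nb r \<inter> nb s"
    using common_neighbour_outside[of "{p, q, r, s, z}" p r s] V cF deg d by auto
  have via_p: False if "r' \<in> {r, s}" "s' \<in> {r, s}" "r' \<noteq> s'" "z' \<in> nb p \<inter> nb r'" for r' s'
  proof -
    have *: "s' \<noteq> q" "s' \<noteq> p" "r' \<noteq> q" "r' \<noteq> p" "r' \<noteq> s'" "dg r' = d" "dg s' = d" "dg q = d" "z \<noteq> r'" "z \<noteq> s'" "z' \<noteq> r'" "z' \<noteq> s'" "p \<noteq> q"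
      using that(1-3) dist deg[of r'] deg[of s'] deg[of q] z(2) z'(1) by auto
    have "s' \<in> nb q \<or> s' \<in> nb r'"
      using adj[of q r' s'] that(1-3) * by simp
    then show False
    proof
      assume "s' \<in> nb q"
      then show False
        using no_equal_degree_path5'[of s' r' q z p z'] * that(4) z z'(1) by auto
    next
      assume "s' \<in> nb r'"
      then show False
        using no_equal_degree_path5'[of q s' z p z' r'] * that(4) z z'(1) by auto
    qed
  qed
  have "r \<in> nb p \<or> r \<in> nb q" by (rule adj) (use dist in auto)
  from z'(2) this show False
  proof (elim disjE)
    assume "z' \<in> nb r \<inter> nb s" "r \<in> nb p"
    then show False using no_equal_degree_path5'[of q s z p r z'] dist deg[of p] deg[of q] deg[of s] z z'(1) by auto
  next
    assume "z' \<in> nb r \<inter> nb s" "r \<in> nb q"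
    then show False using no_equal_degree_path5'[of p s z q r z'] dist deg[of p] deg[of q] deg[of s] z z'(1) by auto
  qed (use via_p[of r s] via_p[of s r] dist in auto)
qed

text \<open>A vertex of the class adjacent to neither of two others is far from them and has their degree, which
  forces the biclique. So any four vertices of the class are almost pairwise adjacent, and a path of
  length five joins two of them.\<close>

lemma large_degree_class_card_le:
  assumes nobic: "\<not> spanning_biclique G n (n + 1)" and d: "n + 1 \<le> d"
  shows "card {v \<in> V. dg v = d} \<le> 3"
proof (rule ccontr)
  assume "\<not> ?thesis"
  then have "4 \<le> card {v \<in> V. dg v = d}" by simp
  then obtain p q r s where T: "p \<in> {v \<in> V. dg v = d}" "q \<in> {v \<in> V. dg v = d}"
    "r \<in> {v \<in> V. dg v = d}" "s \<in> {v \<in> V. dg v = d}" "distinct [p, q, r, s]"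
    by (rule four_distinct_of_card)
  have adj: "c \<in> nb a \<or> c \<in> nb b" if "{a, b, c} \<subseteq> {p, q, r, s}" "distinct [a, b, c]" for a b c
  proof (rule ccontr)
    have abc: "a \<in> V" "b \<in> V" "c \<in> V" "dg a = d" "dg b = d" "dg c = d" using that(1) T by auto
    assume "\<not> ?thesis"
    then have "c \<in> far a b" using abc that(2) by (auto simp: far_def link_def)
    then show False using biclique_if_far_large[of a b c] abc that(2) d nobic by auto
  qed
  obtain z where z: "z \<notin> {p, q, r, s}" "z \<in> nb p \<inter> nb q \<or> z \<in> nb p \<inter> nb r \<or> z \<in> nb q \<inter> nb r"
    using common_neighbour_outside[of "{p, q, r, s}" p q r] T d by auto
  from z(2) show False
  proof (elim disjE)
    assume "z \<in> nb p \<inter> nb q"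
    then show False using no_four_nearly_adjacent[of p q r s d z] T d z(1) adj by auto
  next
    assume "z \<in> nb p \<inter> nb r"
    then show False using no_four_nearly_adjacent[of p r q s d z] T d z(1) adj by (auto simp: insert_commute)
  next
    assume "z \<in> nb q \<inter> nb r"
    then show False using no_four_nearly_adjacent[of q r p s d z] T d z(1) adj by (auto simp: insert_commute)
  qed
qed

text \<open>A far vertex of degree above \<open>n\<close> leads to \<open>far_hub_tight\<close>, where all but at most one unit of the degree
  sum \<open>(n - 3) * (n + 1)\<close> is attained by \<open>n - 3\<close> far vertices of degree at most \<open>n + 1\<close>. More than three of them
  then share the degree \<open>n + 1\<close>.\<close>

lemma far_degree_le:
  assumes nobic: "\<not> spanning_biclique G n (n + 1)"
    and uv: "u \<in> V" "v \<in> V" "u \<noteq> v" "dg u = dg v" "n + 1 \<le> dg u" and w: "w \<in> far u v"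
  shows "dg w \<le> n"
proof (rule ccontr)
  assume "\<not> dg w \<le> n"
  obtain x where x: "x \<in> far u v" "\<And>w. w \<in> far u v \<Longrightarrow> dg w \<le> dg x"
    using exists_max_degree[of "far u v"] w by (auto simp: far_def)
  have "n + 1 \<le> dg x" using x(2)[OF w] \<open>\<not> dg w \<le> n\<close> by simp
  note tight = far_hub_tight[OF uv x(1) this x(2)]
  have finf: "finite (far u v)" by (auto simp: far_def)
  have "V = far u v \<union> (link u v \<union> {u, v})" using uv nb_sub by (auto simp: far_def link_def)
  then have "card V = card (far u v) + card (link u v \<union> {u, v})"
    using card_Un_disjoint[of "far u v" "link u v \<union> {u, v}"] by (auto simp: far_def link_def)
  moreover have "card (link u v \<union> {u, v}) = card (link u v) + card {u, v}"
    by (rule card_Un_disjoint) (auto simp: link_def)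
  ultimately have cf: "card (far u v - {x}) = n - 3"
    using tight uv card_V x(1) finf by simp
  have "(\<Sum>w\<in>far u v - {x}. dg w) \<le> (\<Sum>w\<in>far u v - {x}. n + (if dg w = n + 1 then 1 else 0))"
    using x(2) tight by (intro sum_mono) (auto simp: le_Suc_eq)
  also have "\<dots> = (n - 3) * n + card {w \<in> far u v - {x}. dg w = n + 1}"
    using cf finf by (simp add: sum.distrib flip: sum.inter_filter)
  also have "\<dots> \<le> (n - 3) * n + card {v \<in> V. dg v = n + 1}"
    by (intro add_left_mono card_mono) (auto simp: far_def)
  also have "\<dots> \<le> (n - 3) * n + 3"
    using large_degree_class_card_le[OF nobic, of "n + 1"] by simp
  finally have "(n - 3) * (n + 1) \<le> (n - 3) * n + 3 + 1"
    using tight by (auto split: if_splits)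
  then show False using n_ge by simp
qed

section \<open>The largest repeated degree\<close>

lemma dense_degree_sum: "2 * (n\<^sup>2 + n) \<le> (\<Sum>v\<in>V. dg v)"
  using handshake dense by simp

lemma deg_le: "v \<in> V \<Longrightarrow> dg v \<le> 2 * n"
  using deg_less_card_V card_V by fastforce

text \<open>Both claims hold because the degree sum would otherwise be too small. For the second one, a repeated
  degree of at least \<open>n + 4\<close> would push all other degrees down to \<open>n\<close> or less. For a smaller one, only the
  degrees \<open>n + 1\<close>, \<open>n + 2\<close>, \<open>n + 3\<close> exceed \<open>n\<close>. They occur at most three times each, and those above the
  repeated degree at most once, so the total excess over \<open>n\<close> is at most 9, whereas the number of edges
  demands at least \<open>n\<close>.\<close>

lemma second_degree_large:
  assumes nobic: "\<not> spanning_biclique G n (n + 1)"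
    and uv: "u \<in> V" "v \<in> V" "u \<noteq> v" "dg u = dg v" "n + 1 \<le> dg u"
    and largest: "\<And>a b. a \<in> V \<Longrightarrow> b \<in> V \<Longrightarrow> a \<noteq> b \<Longrightarrow> dg a = dg b \<Longrightarrow> dg a \<le> dg u"
    and x: "x \<in> V - {u, v}" "\<And>w. w \<in> V - {u, v} \<Longrightarrow> dg w \<le> dg x"
  shows "n \<le> dg x" "2 * n + 5 \<le> dg x + dg u"
proof -
  have "(\<Sum>w\<in>V. dg w) = (\<Sum>w\<in>V - {u, v}. dg w) + (\<Sum>w\<in>{u, v}. dg w)"
    using uv by (intro sum.subset_diff) auto
  also have "(\<Sum>w\<in>V - {u, v}. dg w) \<le> card (V - {u, v}) * dg x"
    using x(2) sum_bounded_above[of "V - {u, v}" dg "dg x"] by simp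
  also have "card (V - {u, v}) = 2 * n - 1" using uv card_V by (subst card_Diff_subset) auto
  also have "(\<Sum>w\<in>{u, v}. dg w) = 2 * dg u" using uv by simp
  finally have "2 * (n\<^sup>2 + n) \<le> (2 * n - 1) * dg x + 2 * dg u" using dense_degree_sum by simp
  then have "int (2 * (n\<^sup>2 + n)) \<le> int ((2 * n - 1) * dg x + 2 * dg u)" by (simp only: of_nat_le_iff)
  then have sum: "2 * ((int n)\<^sup>2 + int n) \<le> (2 * int n - 1) * int (dg x) + 2 * int (dg u)"
    using n_ge by (simp add: of_nat_diff)
  show "n \<le> dg x"
  proof (rule ccontr)
    assume "\<not> n \<le> dg x"
    then have "(2 * int n - 1) * int (dg x) \<le> (2 * int n - 1) * (int n - 1)"
      using n_ge by (intro mult_left_mono) auto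
    then show False using sum deg_le[OF uv(1)] n_ge by (simp add: algebra_simps power2_eq_square)
  qed
  show "2 * n + 5 \<le> dg x + dg u"
  proof (rule ccontr)
    assume "\<not> ?thesis"
    then have small: "dg x + dg u \<le> 2 * n + 4" by simp
    show False
    proof (cases "n + 4 \<le> dg u")
      case True
      define k where "k = int (dg u) - int n - 4"
      have k: "0 \<le> k" "int (dg u) = int n + 4 + k" using True by (auto simp: k_def)
      have "(2 * int n - 1) * int (dg x) \<le> (2 * int n - 1) * (int n - k)"
        using small k n_ge by (intro mult_left_mono) auto
      moreover have "0 \<le> (2 * int n - 3) * k" using k n_ge by (intro mult_nonneg_nonneg) auto
      ultimately show False using sum k(2) n_ge by (simp add: algebra_simps power2_eq_square)
    next
      case False
      (* The vertices whose degree exceeds n by exactly i. *)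
      define T where "T i = {w \<in> V. dg w = n + i}" for i
      have T3: "card (T i) \<le> 3" if "1 \<le> i" for i
        unfolding T_def using that by (intro large_degree_class_card_le[OF nobic]) auto
      have T1: "card (T i) \<le> 1" if "dg u < n + i" for i
      proof -
        have "\<forall>a\<in>T i. \<forall>b\<in>T i. a = b"
          using that largest unfolding T_def by fastforce
        then show ?thesis using card_le_Suc0_iff_eq[of "T i"] by (simp add: T_def)
      qed
      have T0: "T i \<subseteq> {u, v}" if "dg x < n + i" for i
        using that x(2) unfolding T_def by fastforce
      have le: "dg w \<le> n + 3" if "w \<in> V" for w
        using x(2)[of w] that small False uv by (cases "w \<in> {u, v}") auto
      have "(\<Sum>w\<in>V. dg w) \<le> (\<Sum>w\<in>V. n + (if dg w = n + 1 then 1 else 0)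
          + (if dg w = n + 2 then 2 else 0) + (if dg w = n + 3 then 3 else 0))"
        using le by (intro sum_mono) (fastforce simp: le_Suc_eq numeral_eq_Suc)
      also have "\<dots> = (2 * n + 1) * n + card (T 1) + 2 * card (T 2) + 3 * card (T 3)"
        using card_V by (simp add: sum.distrib T_def flip: sum.inter_filter)
      finally have "2 * (n\<^sup>2 + n) \<le> (2 * n + 1) * n + card (T 1) + 2 * card (T 2) + 3 * card (T 3)"
        using dense_degree_sum by simp
      moreover have "card (T 1) + 2 * card (T 2) + 3 * card (T 3) \<le> 9"
      proof -
        consider "dg u = n + 1" | "dg u = n + 2" | "dg u = n + 3" using False uv(5) by linarith
        then show ?thesis
        proof cases
          case 1
          then show ?thesis using T3[of 1] T1[of 2] T1[of 3] by simp
        next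
          case 2
          have "T 3 \<subseteq> {}" using T0[of 3] small 2 uv(4) by (auto simp: T_def)
          then show ?thesis using T3[of 1] T3[of 2] by simp
        next
          case 3
          have "T 2 \<subseteq> {}" using T0[of 2] small 3 uv(4) by (auto simp: T_def)
          moreover have "card (T 3) \<le> card {u, v}" using T0[of 3] small 3 by (intro card_mono) auto
          ultimately show ?thesis using T3[of 1] uv(3) by simp
        qed
      qed
      ultimately show False using n_ge by (simp add: power2_eq_square algebra_simps)
    qed
  qed
qed

text \<open>The vertex of largest degree outside the pair is a hub, and all far vertices have degree at most
  \<open>n\<close>; the edge count then stays below \<open>n\<^sup>2 + n\<close>.\<close>

lemma no_large_repeated_degree:
  assumes nobic: "\<not> spanning_biclique G n (n + 1)"
    and uv: "u \<in> V" "v \<in> V" "u \<noteq> v" "dg u = dg v" "n + 1 \<le> dg u"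
    and largest: "\<And>a b. a \<in> V \<Longrightarrow> b \<in> V \<Longrightarrow> a \<noteq> b \<Longrightarrow> dg a = dg b \<Longrightarrow> dg a \<le> dg u"
  shows False
proof -
  have "card (V - {u, v}) \<noteq> 0" using uv card_V n_ge by (subst card_Diff_subset) auto
  then have "V - {u, v} \<noteq> {}" by auto
  then obtain x where x: "x \<in> V - {u, v}" "\<And>w. w \<in> V - {u, v} \<Longrightarrow> dg w \<le> dg x"
    using exists_max_degree[of "V - {u, v}"] by blast
  have large: "n \<le> dg x" "2 * n + 5 \<le> dg x + dg u"
    using second_degree_large[OF nobic uv _ x] largest by blast+
  have hub: "hub u v x" using uv x(1) large card_V by (intro hub_if_large_degrees) auto
  define Y W W1 C where defs: "Y = nb x - {u, v}" "W = far u v - Y - {x}" "W1 = far u v \<inter> Y" "C = link u v - Y - {x}"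
  note cards = hub_cards[OF hub uv(1-3), folded defs(1), folded defs(2-4)]
  note bound = hub_edge_bound[OF hub uv(1-3), folded defs(1), folded defs(2-4)]
  have "(\<Sum>w\<in>W. dg w) \<le> card W * n"
    using sum_bounded_above[of W dg n] far_degree_le[OF nobic uv] by (auto simp: defs)
  then have "card E \<le> card W * n + (card W1 choose 2) + (card C choose 2) + dg x + 2 * dg u"
    using bound cards(4) uv(4) by linarith
  then have "int (n\<^sup>2 + n) \<le> int (card W * n + (card W1 choose 2) + (card C choose 2) + dg x + 2 * dg u)"
    using dense by (simp only: of_nat_le_iff)
  then have e: "2 * (int n)\<^sup>2 + 2 * int n \<le> 2 * (int n * int (card W)) + int (card W1) * (int (card W1) - 1)
      + int (card C) * (int (card C) - 1) + 2 * int (dg x) + 4 * int (dg u)"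
    unfolding choose_two_int[symmetric] by (simp add: algebra_simps)
  have link: "dg u \<le> card (link u v) + 1" using card_link_ge[of u v] by (auto split: if_splits)
  have "2 * (int n * int (card W)) + int (card W1) * (int (card W1) - 1)
      + int (card C) * (int (card C) - 1) + 6 * int n + 4 * (int (dg u) - int n) + 2 * (int (dg x) - int n)
      < 2 * (int n)\<^sup>2 + 2 * int n"
    by (rule near_hub_count) (use n_ge uv(5) large cards card_V link in \<open>auto split: if_splits\<close>)
  then show False using e by (simp add: algebra_simps)
qed

text \<open>Degrees above the repeated degree \<open>t\<close> are pairwise distinct, so their excesses over \<open>t\<close> sum to at most
  a triangular number. A degree sum this large requires a vertex \<open>x\<close> of such a degree that it is a hub. But
  then the at least \<open>t - 2\<close> other link vertices have degree far below \<open>t\<close>, by \<open>link_deg_le\<close>, and the degree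
  sum drops below the required value.\<close>

lemma no_small_repeated_degree:
  assumes uv: "u \<in> V" "v \<in> V" "u \<noteq> v" "dg u = dg v" "dg u \<le> n"
    and largest: "\<And>a b. a \<in> V \<Longrightarrow> b \<in> V \<Longrightarrow> a \<noteq> b \<Longrightarrow> dg a = dg b \<Longrightarrow> dg a \<le> dg u"
  shows False
proof -
  obtain x where x: "x \<in> V" "\<And>w. w \<in> V \<Longrightarrow> dg w \<le> dg x"
    using exists_max_degree[of V] uv by blast
  have xu: "dg u \<le> dg x" using x(2) uv by auto
  let ?t = "int (dg u)" and ?d = "int (dg x)"
  (* The truncated difference is the excess over the repeated degree and vanishes below it. *)
  have inj: "inj_on (\<lambda>w. dg w - dg u) {w \<in> V. 0 < dg w - dg u}"
    using largest unfolding inj_on_def by fastforce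
  have "2 * (\<Sum>w\<in>V. dg w - dg u) \<le> (dg x - dg u) * (dg x - dg u + 1)"
    by (rule sum_le_gauss_if_distinct_positive) (use x(2) inj in \<open>auto intro: diff_le_mono\<close>)
  then have "int (2 * (\<Sum>w\<in>V. dg w - dg u)) \<le> int ((dg x - dg u) * (dg x - dg u + 1))"
    by (simp only: of_nat_le_iff)
  then have gauss: "2 * int (\<Sum>w\<in>V. dg w - dg u) \<le> (?d - ?t) * (?d - ?t + 1)"
    by (simp only: of_nat_mult of_nat_add of_nat_diff[OF xu] of_nat_numeral of_nat_1)
  have "(\<Sum>w\<in>V. dg w) \<le> (\<Sum>w\<in>V. dg u + (dg w - dg u))" by (intro sum_mono) auto
  also have "\<dots> = (2 * n + 1) * dg u + (\<Sum>w\<in>V. dg w - dg u)" using card_V by (simp add: sum.distrib)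
  finally have "int (2 * (n\<^sup>2 + n)) \<le> int ((2 * n + 1) * dg u + (\<Sum>w\<in>V. dg w - dg u))"
    using dense_degree_sum by (simp only: of_nat_le_iff)
  then have "4 * (int n)\<^sup>2 + 4 * int n \<le> 2 * ((2 * int n + 1) * ?t) + (?d - ?t) * (?d - ?t + 1)"
    using gauss by (simp add: ring_distribs)
  then have "2 * int n + 5 \<le> ?d + ?t"
    using xu n_ge uv deg_le[OF x(1)] by (intro repeated_arith_lower) auto
  then have dt: "2 * n + 5 \<le> dg x + dg u" by linarith
  then have "x \<noteq> u" "x \<noteq> v" using uv by auto
  then have hub: "hub u v x" using uv x(1) dt card_V by (intro hub_if_large_degrees) auto
  (* Each link vertex other than x falls short of the repeated degree by at least g. *)
  define g where "g = dg x + dg u - (2 * n + 3)"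
  define C where "C = link u v - {x}"
  have finC: "finite C" "C \<subseteq> V" using nb_sub by (auto simp: C_def link_def)
  have C: "dg y + g \<le> dg u" if "y \<in> C" for y
    using link_deg_le[OF hub, of y] that card_V dt by (auto simp: C_def g_def)
  have "(\<Sum>w\<in>V. dg w + (if w \<in> C then g else 0)) \<le> (\<Sum>w\<in>V. dg u + (dg w - dg u))"
    using C by (intro sum_mono) fastforce
  also have "\<dots> = (2 * n + 1) * dg u + (\<Sum>w\<in>V. dg w - dg u)" using card_V by (simp add: sum.distrib)
  also have "(\<Sum>w\<in>V. dg w + (if w \<in> C then g else 0)) = (\<Sum>w\<in>V. dg w) + card C * g"
    using finC by (simp add: sum.distrib sum.If_cases Int_absorb1)
  finally have "2 * (n\<^sup>2 + n) + card C * g \<le> (2 * n + 1) * dg u + (\<Sum>w\<in>V. dg w - dg u)"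
    using dense_degree_sum by linarith
  moreover have "(dg u - 2) * g \<le> card C * g"
  proof (intro mult_right_mono)
    have "card (link u v) \<le> card C + 1" by (auto simp: C_def card_Diff_singleton_if)
    then show "dg u - 2 \<le> card C" using card_link_ge[of u v] by (auto split: if_splits)
  qed simp
  ultimately have "int (2 * (n\<^sup>2 + n) + (dg u - 2) * g) \<le> int ((2 * n + 1) * dg u + (\<Sum>w\<in>V. dg w - dg u))"
    by (simp only: of_nat_le_iff)
  moreover have "2 \<le> dg u" using dt deg_le[OF x(1)] by linarith
  ultimately have "4 * (int n)\<^sup>2 + 4 * int n + 2 * ((?t - 2) * (?d + ?t - (2 * int n + 3)))
      \<le> 2 * ((2 * int n + 1) * ?t) + (?d - ?t) * (?d - ?t + 1)"
    using gauss dt by (simp add: g_def of_nat_diff ring_distribs)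
  then show False
    by (rule repeated_arith_contra[rotated -1]) (use n_ge uv deg_le[OF x(1)] dt in auto)
qed

text \<open>With pairwise distinct degrees the degree sum would be at most \<open>n * (2 * n + 1)\<close>.\<close>

lemma exists_largest_repeated_degree:
  obtains u v where "u \<in> V" "v \<in> V" "u \<noteq> v" "dg u = dg v"
    and "\<And>a b. a \<in> V \<Longrightarrow> b \<in> V \<Longrightarrow> a \<noteq> b \<Longrightarrow> dg a = dg b \<Longrightarrow> dg a \<le> dg u"
proof -
  let ?S = "{a \<in> V. \<exists>b \<in> V. a \<noteq> b \<and> dg a = dg b}"
  have "?S \<noteq> {}"
  proof
    assume "?S = {}"
    then have "inj_on dg {v \<in> V. 0 < dg v}" by (auto simp: inj_on_def)
    then have "2 * (\<Sum>v\<in>V. dg v) \<le> 2 * n * (2 * n + 1)"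
      using deg_le by (intro sum_le_gauss_if_distinct_positive) auto
    then show False using dense_degree_sum n_ge by (simp add: algebra_simps power2_eq_square)
  qed
  then obtain u where u: "u \<in> ?S" "\<And>w. w \<in> ?S \<Longrightarrow> dg w \<le> dg u"
    using exists_max_degree[of ?S] by blast
  then obtain v where "v \<in> V" "u \<noteq> v" "dg u = dg v" by blast
  then show thesis using that[of u v] u by blast
qed

theorem is_spanning_biclique: "spanning_biclique G n (n + 1)"
proof (rule ccontr)
  assume nobic: "\<not> ?thesis"
  obtain u v where "u \<in> V" "v \<in> V" "u \<noteq> v" "dg u = dg v"
    and "\<And>a b. a \<in> V \<Longrightarrow> b \<in> V \<Longrightarrow> a \<noteq> b \<Longrightarrow> dg a = dg b \<Longrightarrow> dg a \<le> dg u"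
    using exists_largest_repeated_degree by blast
  then show False
    using no_large_repeated_degree[OF nobic] no_small_repeated_degree by (metis Suc_eq_plus1 not_less_eq_eq)
qed

end

section \<open>The complete bipartite graph and the extremal number\<close>

lemma complete_bipartite_simple: "simple_graph (complete_bipartite a b)"
  by (auto simp: simple_graph_def complete_bipartite_def)

lemma spanning_biclique_complete_bipartite: "spanning_biclique (complete_bipartite a b) a b"
  unfolding spanning_biclique_def
  by (intro exI[of _ "{..<a}"] exI[of _ "{a..<a + b}"]) (auto simp: complete_bipartite_def)

lemma spanning_biclique_card_edges:
  assumes "spanning_biclique G a b"
  shows "card (edges G) = a * b"
proof -
  obtain X Z where XZ: "X \<inter> Z = {}" "card X = a" "card Z = b" "edges G = {{x, z} |x z. x \<in> X \<and> z \<in> Z}"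
    using assms by (auto simp: spanning_biclique_def)
  have "inj_on (\<lambda>(x, z). {x, z}) (X \<times> Z)" using XZ(1) by (auto simp: inj_on_def doubleton_eq_iff)
  moreover have "edges G = (\<lambda>(x, z). {x, z}) ` (X \<times> Z)" using XZ(4) by auto
  ultimately show ?thesis using XZ by (simp add: card_image card_cartesian_product)
qed

lemma spanning_bicliques_iso:
  assumes "spanning_biclique G a b" "spanning_biclique H a b" "finite (verts G)" "finite (verts H)"
  shows "graph_iso G H"
proof -
  obtain X Z where G: "X \<inter> Z = {}" "verts G = X \<union> Z" "card X = a" "card Z = b"
    "edges G = {{x, z} |x z. x \<in> X \<and> z \<in> Z}"
    using assms(1) by (auto simp: spanning_biclique_def)
  obtain X' Z' where H: "X' \<inter> Z' = {}" "verts H = X' \<union> Z'" "card X' = a" "card Z' = b"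
    "edges H = {{x, z} |x z. x \<in> X' \<and> z \<in> Z'}"
    using assms(2) by (auto simp: spanning_biclique_def)
  obtain f where f: "bij_betw f X X'"
    using finite_same_card_bij[of X X'] assms G H by auto
  obtain g where g: "bij_betw g Z Z'"
    using finite_same_card_bij[of Z Z'] assms G H by auto
  define h where "h v = (if v \<in> X then f v else g v)" for v
  have hX: "bij_betw h X X'" using f by (rule bij_betw_cong[THEN iffD1, rotated]) (simp add: h_def)
  have hZ: "bij_betw h Z Z'" using g
    by (rule bij_betw_cong[THEN iffD1, rotated]) (use G(1) in \<open>auto simp: h_def\<close>)
  have "bij_betw h (verts G) (verts H)"
    unfolding G(2) H(2) using hX hZ H(1) by (rule bij_betw_combine)
  moreover have "h v \<in> X' \<longleftrightarrow> v \<in> X" "h v \<in> Z' \<longleftrightarrow> v \<in> Z" if "v \<in> verts G" for v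
    using that bij_betwE[OF hX] bij_betwE[OF hZ] G(1,2) H(1) by blast+
  moreover have "{u, v} \<in> edges G \<longleftrightarrow> u \<in> X \<and> v \<in> Z \<or> v \<in> X \<and> u \<in> Z" for u v
    unfolding G(5) by (auto simp: doubleton_eq_iff)
  moreover have "{u, v} \<in> edges H \<longleftrightarrow> u \<in> X' \<and> v \<in> Z' \<or> v \<in> X' \<and> u \<in> Z'" for u v
    unfolding H(5) by (auto simp: doubleton_eq_iff)
  ultimately show ?thesis unfolding graph_iso_def by (intro exI[of _ h]) auto
qed

text \<open>A path of odd length joins the two sides, whose degrees \<open>a\<close> and \<open>b\<close> differ.\<close>

lemma complete_bipartite_no_equal_degree_path:
  assumes "a \<noteq> b" "odd l"
  shows "\<not> has_equal_degree_path (complete_bipartite a b) l"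
proof
  let ?K = "complete_bipartite a b"
  assume "has_equal_degree_path ?K l"
  then obtain p where p: "is_path ?K p" "length p = l + 1" "deg ?K (hd p) = deg ?K (last p)"
    by (auto simp: has_equal_degree_path_def joined_by_path_def)
  interpret simple_ugraph ?K by unfold_locales (rule complete_bipartite_simple)
  have edge: "{i, j} \<in> edges ?K \<longleftrightarrow> i < a \<and> a \<le> j \<and> j < a + b \<or> j < a \<and> a \<le> i \<and> i < a + b" for i j
    by (auto simp: complete_bipartite_def doubleton_eq_iff)
  have deg: "deg ?K i = (if i < a then b else a)" if "i < a + b" for i
  proof -
    have "nb i = (if i < a then {a..<a + b} else {..<a})" using that by (auto simp: nb_def edge)
    then show ?thesis by (simp add: deg_eq_card_nb)
  qed
  have side: "i < length q \<Longrightarrow> (q ! i < a) = ((hd q < a) = even i)"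
    if "successively (\<lambda>x y. {x, y} \<in> edges ?K) q" for q :: "nat list" and i
    using that
  proof (induction i)
    case 0
    then show ?case by (cases q) auto
  next
    case (Suc i)
    then have "{q ! i, q ! Suc i} \<in> edges ?K" by (simp add: successively_conv_nth)
    then show ?case using Suc by (auto simp: edge)
  qed
  have "p \<noteq> []" "set p \<subseteq> {..<a + b}" using p(1) by (auto simp: is_path_def complete_bipartite_def)
  then have "hd p < a + b" "last p < a + b" by (auto dest: hd_in_set last_in_set)
  moreover have "(last p < a) \<noteq> (hd p < a)"
    using side[of p l] p(1,2) \<open>p \<noteq> []\<close> \<open>odd l\<close> by (auto simp: is_path_def last_conv_nth)
  ultimately show False using p(3) assms(1) by (auto simp: deg split: if_splits)
qed

lemma dense_graph_spanning_biclique: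
  assumes "11 \<le> n" "simple_graph G" "card (verts G) = 2 * n + 1" "n\<^sup>2 + n \<le> card (edges G)"
    and "\<not> has_equal_degree_path G 5"
  shows "spanning_biclique G n (n + 1)"
proof -
  interpret dense_graph G n by unfold_locales (use assms in auto)
  show ?thesis by (rule is_spanning_biclique)
qed

theorem theorem1p4:
  fixes n :: nat
  assumes "n \<ge> 11"
  shows "(let K = complete_bipartite n (n + 1) in
            simple_graph K \<and> card (verts K) = 2 * n + 1 \<and> card (edges K) \<ge> n^2 + n
              \<and> \<not> has_equal_degree_path K 5
            \<and> (\<forall>G :: 'a ugraph.
                 simple_graph G \<and> card (verts G) = 2 * n + 1 \<and> card (edges G) \<ge> n^2 + n
                   \<and> \<not> has_equal_degree_path G 5
                 \<longrightarrow> graph_iso G K))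
         \<and> p_max 5 (2 * n + 1) = n^2 + n"
proof -
  let ?K = "complete_bipartite n (n + 1)"
  have K: "simple_graph ?K" "card (verts ?K) = 2 * n + 1" "\<not> has_equal_degree_path ?K 5"
    by (simp_all add: complete_bipartite_simple complete_bipartite_no_equal_degree_path)
      (simp add: complete_bipartite_def)
  have e: "card (edges ?K) = n\<^sup>2 + n"
    using spanning_biclique_card_edges[OF spanning_biclique_complete_bipartite]
    by (simp add: power2_eq_square)
  have "graph_iso G ?K"
    if "simple_graph G" "card (verts G) = 2 * n + 1" "card (edges G) \<ge> n\<^sup>2 + n" "\<not> has_equal_degree_path G 5"
    for G :: "'a ugraph"
  proof (rule spanning_bicliques_iso)
    show "spanning_biclique G n (n + 1)" using assms that by (rule dense_graph_spanning_biclique)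
    show "spanning_biclique ?K n (n + 1)" by (rule spanning_biclique_complete_bipartite)
  qed (use that K(1) in \<open>auto simp: simple_graph_def\<close>)
  moreover have "p_max 5 (2 * n + 1) = n\<^sup>2 + n"
    unfolding p_max_def
  proof (rule Max_eqI)
    fix k
    assume "k \<in> {card (edges G) |G :: nat ugraph. simple_graph G \<and> card (verts G) = 2 * n + 1
      \<and> \<not> has_equal_degree_path G 5}"
    then obtain G :: "nat ugraph" where G: "k = card (edges G)" "simple_graph G"
      "card (verts G) = 2 * n + 1" "\<not> has_equal_degree_path G 5" by blast
    show "k \<le> n\<^sup>2 + n"
    proof (rule ccontr)
      assume "\<not> ?thesis"
      then have "spanning_biclique G n (n + 1)"
        using dense_graph_spanning_biclique[of n G] assms G by simp
      then have "k = n * (n + 1)" using spanning_biclique_card_edges G(1) by blast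
      then show False using \<open>\<not> k \<le> n\<^sup>2 + n\<close> by (simp add: power2_eq_square)
    qed
  next
    show "n\<^sup>2 + n \<in> {card (edges G) |G :: nat ugraph. simple_graph G \<and> card (verts G) = 2 * n + 1
      \<and> \<not> has_equal_degree_path G 5}"
      using K e by force
  qed (rule p_max_set_finite_nonempty)
  ultimately show ?thesis using K e by (simp add: Let_def)
qed

end
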